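(* Let $\mathbf{C}$ be a preadditive category in which there do not exist non-zero maximal objects with respect to $\preceq$ (that is, for every non-zero object $A$ of $\mathbf{C}$ there exists an object $B$ of $\mathbf{C}$ with $A\prec B$). Then $\mathbf{C}$ does not have maximal ideals.
   Context: A preadditive category is a category with an abelian group structure on each hom-set such that composition is bilinear. For objects $A,B$ of a preadditive category $\mathbf{C}$, write $A\prec B$ if there exists an infinite subset $E\subseteq \operatorname{Hom}_{\mathbf{C}}(B,A)\times\operatorname{Hom}_{\mathbf{C}}(A,B)$ such that (1) $fg=1_A$ for every $(f,g)\in E$; and (2) for each $\varphi\in\operatorname{Hom}_{\mathbf{C}}(A,B)$, $|\{(f,g)\in E: f\varphi\neq 0\}|<|E|$. The relation $\prec$ is a strict order on objects, and $A\preceq B$ means $A\prec B$ or $A=B$. An object $A$ is maximal with respect to $\preceq$ if there is no object $B$ of $\mathbf{C}$ with $A\prec B$. An ideal $\mathcal{I}$ of $\mathbf{C}$ is an additive subfunctor of $\operatorname{Hom}_{\mathbf{C}}\colon\mathbf{C}^{op}\times\mathbf{C}\to\mathbf{Ab}$: it assigns to each pair of objects $A,B$ a subgroup $\mathcal{I}(A,B)$ of $\operatorname{Hom}_{\mathbf{C}}(A,B)$ such that $gif\in\mathcal{I}(X,Y)$ for all $f\colon X\to A$, $i\in\mathcal{I}(A,B)$, $g\colon B\to Y$. An ideal is maximal if it is proper (not equal to $\operatorname{Hom}_{\mathbf{C}}$) and is not properly contained in any other proper ideal. *)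

theory Defs
  imports "HOL-Algebra.Group"
begin

unbundle cardinal_syntax

(* Each hom-set is a commutative group in the sense of HOL-Algebra. Since that record is written
   multiplicatively, the addition of morphisms A -> B is mult (Hom C A B) and the zero morphism is
   one (Hom C A B); the identity morphism of A is Ident C A.
   Comp C X Y Z g f is the composite of f : X -> Y and g : Y -> Z. Composition carries its objects
   as arguments, so distinct hom-sets need not be disjoint. *)
record ('o, 'm) precategory =
  Obj :: "'o set"
  Hom :: "'o \<Rightarrow> 'o \<Rightarrow> 'm monoid"
  Ident :: "'o \<Rightarrow> 'm"
  Comp :: "'o \<Rightarrow> 'o \<Rightarrow> 'o \<Rightarrow> 'm \<Rightarrow> 'm \<Rightarrow> 'm"

abbreviation Mor :: "('o, 'm) precategory \<Rightarrow> 'o \<Rightarrow> 'o \<Rightarrow> 'm set" where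
  "Mor C X Y \<equiv> carrier (Hom C X Y)"

abbreviation Zero :: "('o, 'm) precategory \<Rightarrow> 'o \<Rightarrow> 'o \<Rightarrow> 'm" where
  "Zero C X Y \<equiv> one (Hom C X Y)"

(* The two hom-axioms state bilinearity, and in particular that composites lie in the right hom-set. *)
locale preadditive_category =
  fixes C :: "('o, 'm) precategory"
  assumes Ident_in_Mor: "X \<in> Obj C \<Longrightarrow> Ident C X \<in> Mor C X X"
    and Comp_Ident_right:
      "\<lbrakk>X \<in> Obj C; Y \<in> Obj C; f \<in> Mor C X Y\<rbrakk> \<Longrightarrow> Comp C X X Y f (Ident C X) = f"
    and Comp_Ident_left:
      "\<lbrakk>X \<in> Obj C; Y \<in> Obj C; f \<in> Mor C X Y\<rbrakk> \<Longrightarrow> Comp C X Y Y (Ident C Y) f = f"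
    and Comp_assoc:
      "\<lbrakk>W \<in> Obj C; X \<in> Obj C; Y \<in> Obj C; Z \<in> Obj C;
        f \<in> Mor C W X; g \<in> Mor C X Y; h \<in> Mor C Y Z\<rbrakk> \<Longrightarrow>
       Comp C W X Z (Comp C X Y Z h g) f = Comp C W Y Z h (Comp C W X Y g f)"
    and Hom_comm_group: "\<lbrakk>X \<in> Obj C; Y \<in> Obj C\<rbrakk> \<Longrightarrow> comm_group (Hom C X Y)"
    and Comp_hom_right:
      "\<lbrakk>X \<in> Obj C; Y \<in> Obj C; Z \<in> Obj C; g \<in> Mor C Y Z\<rbrakk> \<Longrightarrow>
       (\<lambda>f. Comp C X Y Z g f) \<in> hom (Hom C X Y) (Hom C X Z)"
    and Comp_hom_left:
      "\<lbrakk>X \<in> Obj C; Y \<in> Obj C; Z \<in> Obj C; f \<in> Mor C X Y\<rbrakk> \<Longrightarrow>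
       (\<lambda>g. Comp C X Y Z g f) \<in> hom (Hom C Y Z) (Hom C X Z)"

definition zero_object :: "('o, 'm) precategory \<Rightarrow> 'o \<Rightarrow> bool" where
  "zero_object C A \<longleftrightarrow> A \<in> Obj C \<and>
     (\<forall>X \<in> Obj C. (\<exists>!f. f \<in> Mor C A X) \<and> (\<exists>!f. f \<in> Mor C X A))"

definition obj_prec :: "('o, 'm) precategory \<Rightarrow> 'o \<Rightarrow> 'o \<Rightarrow> bool" where
  "obj_prec C A B \<longleftrightarrow> A \<in> Obj C \<and> B \<in> Obj C \<and>
     (\<exists>E \<subseteq> Mor C B A \<times> Mor C A B. infinite E \<and>
        (\<forall>(f, g) \<in> E. Comp C A B A f g = Ident C A) \<and>
        (\<forall>\<phi> \<in> Mor C A B. |{(f, g) \<in> E. Comp C A B A f \<phi> \<noteq> Zero C A A}| <o |E| ))"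

definition maximal_object :: "('o, 'm) precategory \<Rightarrow> 'o \<Rightarrow> bool" where
  "maximal_object C A \<longleftrightarrow> A \<in> Obj C \<and> \<not> (\<exists>B \<in> Obj C. obj_prec C A B)"

(* The values of I are only meaningful, and only ever compared, on pairs of objects of C. *)
definition cat_ideal :: "('o, 'm) precategory \<Rightarrow> ('o \<Rightarrow> 'o \<Rightarrow> 'm set) \<Rightarrow> bool" where
  "cat_ideal C I \<longleftrightarrow>
     (\<forall>A \<in> Obj C. \<forall>B \<in> Obj C. subgroup (I A B) (Hom C A B)) \<and>
     (\<forall>X \<in> Obj C. \<forall>A \<in> Obj C. \<forall>B \<in> Obj C. \<forall>Y \<in> Obj C.
        \<forall>f \<in> Mor C X A. \<forall>i \<in> I A B. \<forall>g \<in> Mor C B Y.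
          Comp C X B Y g (Comp C X A B i f) \<in> I X Y)"

definition ideal_le ::
  "('o, 'm) precategory \<Rightarrow> ('o \<Rightarrow> 'o \<Rightarrow> 'm set) \<Rightarrow> ('o \<Rightarrow> 'o \<Rightarrow> 'm set) \<Rightarrow> bool" where
  "ideal_le C I J \<longleftrightarrow> (\<forall>A \<in> Obj C. \<forall>B \<in> Obj C. I A B \<subseteq> J A B)"

definition proper_cat_ideal :: "('o, 'm) precategory \<Rightarrow> ('o \<Rightarrow> 'o \<Rightarrow> 'm set) \<Rightarrow> bool" where
  "proper_cat_ideal C I \<longleftrightarrow> cat_ideal C I \<and> (\<exists>A \<in> Obj C. \<exists>B \<in> Obj C. I A B \<noteq> Mor C A B)"

definition maximal_cat_ideal :: "('o, 'm) precategory \<Rightarrow> ('o \<Rightarrow> 'o \<Rightarrow> 'm set) \<Rightarrow> bool" where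
  "maximal_cat_ideal C I \<longleftrightarrow> proper_cat_ideal C I \<and>
     \<not> (\<exists>J. proper_cat_ideal C J \<and> ideal_le C I J \<and> \<not> ideal_le C J I)"

end

theory Submission
  imports Defs "HOL-Algebra.Generated_Groups"
begin

text \<open>
  Let \<open>M\<close> be a maximal ideal and pick \<open>A\<close> with \<open>1\<^sub>A \<notin> M\<close>. Then \<open>A\<close> is non-zero, so \<open>A \<prec> B\<close>
  for some \<open>B\<close>, witnessed by \<open>E\<close>. The ideal generated by \<open>M\<close> and \<open>1\<^sub>A\<close> is everything, hence
  \<open>1\<^sub>B = m + \<phi>\<^sub>1\<psi>\<^sub>1 + \<dots> + \<phi>\<^sub>n\<psi>\<^sub>n\<close> with \<open>m \<in> M\<close>, \<open>\<phi>\<^sub>i : A \<rightarrow> B\<close> and \<open>\<psi>\<^sub>i : B \<rightarrow> A\<close>. Fewer than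
  \<open>|E|\<close> pairs \<open>(f, g) \<in> E\<close> fail to satisfy \<open>f\<phi>\<^sub>1 = \<dots> = f\<phi>\<^sub>n = 0\<close>; any other pair gives
  \<open>1\<^sub>A = fg = fmg \<in> M\<close>, a contradiction.
\<close>

lemma cat_ideal_subgroup:
  "\<lbrakk>cat_ideal C I; X \<in> Obj C; Y \<in> Obj C\<rbrakk> \<Longrightarrow> subgroup (I X Y) (Hom C X Y)"
  by (simp add: cat_ideal_def)

lemma cat_ideal_Comp:
  "\<lbrakk>cat_ideal C I; X \<in> Obj C; A \<in> Obj C; B \<in> Obj C; Y \<in> Obj C;
    f \<in> Mor C X A; i \<in> I A B; g \<in> Mor C B Y\<rbrakk> \<Longrightarrow>
   Comp C X B Y g (Comp C X A B i f) \<in> I X Y"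
  unfolding cat_ideal_def by blast

lemma cat_ideal_in_Mor:
  "\<lbrakk>cat_ideal C I; X \<in> Obj C; Y \<in> Obj C; f \<in> I X Y\<rbrakk> \<Longrightarrow> f \<in> Mor C X Y"
  using cat_ideal_subgroup subgroup.mem_carrier by metis

text \<open>\<open>I + (1\<^sub>A)\<close>: the ideal generated by \<open>I\<close> and the identity of \<open>A\<close>.\<close>

definition ideal_adjoin ::
  "('o, 'm) precategory \<Rightarrow> ('o \<Rightarrow> 'o \<Rightarrow> 'm set) \<Rightarrow> 'o \<Rightarrow> 'o \<Rightarrow> 'o \<Rightarrow> 'm set" where
  "ideal_adjoin C I A X Y = generate (Hom C X Y)
     (I X Y \<union> {Comp C X A Y \<phi> \<psi> | \<phi> \<psi>. \<phi> \<in> Mor C A Y \<and> \<psi> \<in> Mor C X A})"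

context preadditive_category
begin

lemma Comp_in_Mor:
  "\<lbrakk>X \<in> Obj C; Y \<in> Obj C; Z \<in> Obj C; f \<in> Mor C X Y; g \<in> Mor C Y Z\<rbrakk> \<Longrightarrow>
   Comp C X Y Z g f \<in> Mor C X Z"
  using Comp_hom_right unfolding hom_def by blast

lemma Hom_group: "\<lbrakk>X \<in> Obj C; Y \<in> Obj C\<rbrakk> \<Longrightarrow> group (Hom C X Y)"
  using Hom_comm_group comm_group.axioms(2) by blast

lemma group_hom_Comp_right:
  "\<lbrakk>X \<in> Obj C; Y \<in> Obj C; Z \<in> Obj C; g \<in> Mor C Y Z\<rbrakk> \<Longrightarrow>
   group_hom (Hom C X Y) (Hom C X Z) (\<lambda>f. Comp C X Y Z g f)"
  by (simp add: group_hom_def group_hom_axioms_def Hom_group Comp_hom_right)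

lemma group_hom_Comp_left:
  "\<lbrakk>X \<in> Obj C; Y \<in> Obj C; Z \<in> Obj C; f \<in> Mor C X Y\<rbrakk> \<Longrightarrow>
   group_hom (Hom C Y Z) (Hom C X Z) (\<lambda>g. Comp C X Y Z g f)"
  by (simp add: group_hom_def group_hom_axioms_def Hom_group Comp_hom_left)

lemma ideal_adjoin_generators_in_Mor:
  assumes "cat_ideal C I" "A \<in> Obj C" "X \<in> Obj C" "Y \<in> Obj C"
  shows "I X Y \<union> {Comp C X A Y \<phi> \<psi> | \<phi> \<psi>. \<phi> \<in> Mor C A Y \<and> \<psi> \<in> Mor C X A} \<subseteq> Mor C X Y"
  using assms by (auto intro: cat_ideal_in_Mor Comp_in_Mor)

text \<open>Closure under composition only has to be checked on generators: by bilinearity,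
  two-sided composition \<open>?h\<close> is a homomorphism of hom-groups, so it maps the subgroup
  generated by a set onto the subgroup generated by its image.\<close>

lemma cat_ideal_adjoin:
  assumes I: "cat_ideal C I" and A: "A \<in> Obj C"
  shows "cat_ideal C (ideal_adjoin C I A)"
  unfolding cat_ideal_def
proof (intro conjI ballI)
  fix X Y assume "X \<in> Obj C" "Y \<in> Obj C"
  then show "subgroup (ideal_adjoin C I A X Y) (Hom C X Y)"
    unfolding ideal_adjoin_def
    by (intro group.generate_is_subgroup Hom_group ideal_adjoin_generators_in_Mor I A)
next
  fix W X Y Z f i g
  assume W: "W \<in> Obj C" and X: "X \<in> Obj C" and Y: "Y \<in> Obj C" and Z: "Z \<in> Obj C"
    and f: "f \<in> Mor C W X" and i: "i \<in> ideal_adjoin C I A X Y" and g: "g \<in> Mor C Y Z"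
  let ?K = "\<lambda>X Y. I X Y \<union> {Comp C X A Y \<phi> \<psi> | \<phi> \<psi>. \<phi> \<in> Mor C A Y \<and> \<psi> \<in> Mor C X A}"
  let ?h = "\<lambda>i. Comp C W Y Z g (Comp C W X Y i f)"
  have "group_hom (Hom C X Y) (Hom C W Z) ?h"
    using hom_compose[OF Comp_hom_left[OF W X Y f] Comp_hom_right[OF W Y Z g]]
    by (simp add: group_hom_def group_hom_axioms_def Hom_group W X Y Z comp_def)
  then have "generate (Hom C W Z) (?h ` ?K X Y) = ?h ` generate (Hom C X Y) (?K X Y)"
    by (rule group_hom.generate_img) (rule ideal_adjoin_generators_in_Mor[OF I A X Y])
  moreover have "?h ` ?K X Y \<subseteq> ?K W Z"
  proof (intro image_subsetI)
    fix k assume "k \<in> ?K X Y"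
    then consider "k \<in> I X Y"
      | \<phi> \<psi> where "k = Comp C X A Y \<phi> \<psi>" "\<phi> \<in> Mor C A Y" "\<psi> \<in> Mor C X A" by blast
    then show "?h k \<in> ?K W Z"
    proof cases
      case 1
      then show ?thesis using cat_ideal_Comp[OF I W X Y Z f _ g] by simp
    next
      case 2
      \<comment> \<open>Reassociating g(\<phi>\<psi>)f as (g\<phi>)(\<psi>f) shows that the result
        still factors through \<open>A\<close>.\<close>
      then have "?h k = Comp C W A Z (Comp C A Y Z g \<phi>) (Comp C W X A \<psi> f)"
        using A W X Y Z f g by (simp add: Comp_assoc Comp_in_Mor)
      moreover have "Comp C A Y Z g \<phi> \<in> Mor C A Z" "Comp C W X A \<psi> f \<in> Mor C W A"
        using 2 A W X Y Z f g by (simp_all add: Comp_in_Mor)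
      ultimately show ?thesis by blast
    qed
  qed
  then have "generate (Hom C W Z) (?h ` ?K X Y) \<subseteq> generate (Hom C W Z) (?K W Z)"
    by (rule group.mono_generate[OF Hom_group[OF W Z]])
  ultimately show "?h i \<in> ideal_adjoin C I A W Z"
    using i unfolding ideal_adjoin_def by blast
qed

lemma ideal_le_adjoin: "ideal_le C I (ideal_adjoin C I A)"
  unfolding ideal_le_def ideal_adjoin_def by (auto intro: generate.incl)

lemma Ident_in_ideal_adjoin:
  assumes "A \<in> Obj C"
  shows "Ident C A \<in> ideal_adjoin C I A A A"
proof -
  have "Ident C A = Comp C A A A (Ident C A) (Ident C A)"
    using assms by (simp add: Comp_Ident_left Ident_in_Mor)
  then show ?thesis
    unfolding ideal_adjoin_def using Ident_in_Mor[OF assms] by (intro generate.incl) blast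
qed

text \<open>The adjoined ideal contains \<open>M\<close> and also \<open>Ident C A\<close>, which
  \<open>M\<close> omits; by maximality it cannot be proper.\<close>

lemma maximal_cat_ideal_adjoin_eq_Mor:
  assumes M: "maximal_cat_ideal C M" and A: "A \<in> Obj C" "Ident C A \<notin> M A A"
    and "X \<in> Obj C" "Y \<in> Obj C"
  shows "ideal_adjoin C M A X Y = Mor C X Y"
proof -
  have "cat_ideal C M"
    using M by (simp add: maximal_cat_ideal_def proper_cat_ideal_def)
  moreover have "\<not> ideal_le C (ideal_adjoin C M A) M"
    using A Ident_in_ideal_adjoin unfolding ideal_le_def by blast
  ultimately show ?thesis
    using assms cat_ideal_adjoin[of M A] ideal_le_adjoin[of M A]
    unfolding maximal_cat_ideal_def proper_cat_ideal_def by blast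
qed

text \<open>Take for \<open>A\<close> the domain of a hom-set that \<open>I\<close> does not
  exhaust: were its identity in \<open>I\<close>, every f : A -> B would be, since f = f 1
  1.\<close>

lemma proper_cat_ideal_Ident_notin:
  assumes "proper_cat_ideal C I"
  obtains A where "A \<in> Obj C" "Ident C A \<notin> I A A"
proof -
  obtain A B where I: "cat_ideal C I" and A: "A \<in> Obj C" and B: "B \<in> Obj C"
    and neq: "I A B \<noteq> Mor C A B"
    using assms unfolding proper_cat_ideal_def by blast
  have "Ident C A \<notin> I A A"
  proof
    assume "Ident C A \<in> I A A"
    then have "f \<in> I A B" if "f \<in> Mor C A B" for f
      using cat_ideal_Comp[OF I A A A B Ident_in_Mor[OF A] _ that, of "Ident C A"] that A B
      by (simp add: Comp_Ident_right Ident_in_Mor)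
    then show False
      using neq cat_ideal_in_Mor[OF I A B] by blast
  qed
  with A show ?thesis by (rule that)
qed

text \<open>The only endomorphism of a zero object is the zero morphism, which every ideal
  contains.\<close>

lemma zero_object_Ident_in_cat_ideal:
  assumes "zero_object C A" "cat_ideal C I"
  shows "Ident C A \<in> I A A"
proof -
  have A: "A \<in> Obj C" and uniq: "\<exists>!f. f \<in> Mor C A A"
    using assms(1) by (auto simp: zero_object_def)
  have "Zero C A A \<in> I A A"
    using cat_ideal_subgroup[OF assms(2) A A] by (rule subgroup.one_closed)
  then show ?thesis
    using uniq Ident_in_Mor[OF A] cat_ideal_in_Mor[OF assms(2) A A] by metis
qed

text \<open>Induction over the generated subgroup replaces an explicit decomposition of
  \<open>x\<close> into an element of \<open>I\<close> plus a finite sum of composites \<phi>\<psi>.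
  The element \<open>m\<close> is the part from \<open>I\<close>; the rest is killed by
  \<open>f\<close> for all pairs outside a small exceptional set.\<close>

lemma ideal_adjoin_almost_in_ideal:
  assumes I: "cat_ideal C I" and A: "A \<in> Obj C" and B: "B \<in> Obj C" and X: "X \<in> Obj C"
    and E: "E \<subseteq> Mor C B A \<times> Mor C A B" "infinite E"
    and small: "\<And>\<phi>. \<phi> \<in> Mor C A B \<Longrightarrow>
      |{(f, g) \<in> E. Comp C A B A f \<phi> \<noteq> Zero C A A}| <o |E|"
    and x: "x \<in> ideal_adjoin C I A X B"
  shows "\<exists>m \<in> I X B. |{(f, g) \<in> E. Comp C X B A f x \<noteq> Comp C X B A f m}| <o |E|"
proof -
  interpret G: group "Hom C X B" by (rule Hom_group[OF X B])
  interpret S: subgroup "I X B" "Hom C X B" by (rule cat_ideal_subgroup[OF I X B])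
  \<comment> \<open>Covers the cases without exceptional pairs: elements of \<open>I\<close> and the
    zero morphism.\<close>
  have empty: "|{} :: ('m \<times> 'm) set| <o |E|"
    by (rule finite_ordLess_infinite[OF card_of_Well_order card_of_Well_order])
      (simp_all add: Field_card_of E(2))
  have generator: "\<exists>m \<in> I X B. |{(f, g) \<in> E. Comp C X B A f k \<noteq> Comp C X B A f m}| <o |E|"
    if "k \<in> I X B \<union> {Comp C X A B \<phi> \<psi> | \<phi> \<psi>. \<phi> \<in> Mor C A B \<and> \<psi> \<in> Mor C X A}" for k
    using that
  proof (elim UnE CollectE exE conjE)
    assume "k \<in> I X B"
    then show ?thesis using empty by (intro bexI[of _ k]) auto
  next
    fix \<phi> \<psi> assume k: "k = Comp C X A B \<phi> \<psi>" and \<phi>: "\<phi> \<in> Mor C A B" and \<psi>: "\<psi> \<in> Mor C X A"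
    \<comment> \<open>For k = \<phi>\<psi> the witness is m = 0: if f\<phi> = 0, then fk = 0\<psi> =
      0 = f0.\<close>
    have "Comp C X B A f k = Comp C X B A f (Zero C X B)"
      if "f \<in> Mor C B A" "Comp C A B A f \<phi> = Zero C A A" for f
    proof -
      have "Comp C X B A f k = Comp C X A A (Zero C A A) \<psi>"
        using that k \<phi> \<psi> A B X by (metis Comp_assoc)
      then show ?thesis
        using group_hom.hom_one[OF group_hom_Comp_left[OF X A A \<psi>]]
          group_hom.hom_one[OF group_hom_Comp_right[OF X B A that(1)]] by simp
    qed
    then have "{(f, g) \<in> E. Comp C X B A f k \<noteq> Comp C X B A f (Zero C X B)}
        \<subseteq> {(f, g) \<in> E. Comp C A B A f \<phi> \<noteq> Zero C A A}"
      using E(1) by blast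
    then show ?thesis
      using small[OF \<phi>] S.one_closed card_of_mono1 ordLeq_ordLess_trans by blast
  qed
  note in_Mor = ideal_adjoin_generators_in_Mor[OF I A X B]
  show ?thesis
    using x[unfolded ideal_adjoin_def]
  proof (induction rule: generate.induct)
    case one
    show ?case using empty S.one_closed by (intro bexI[of _ "Zero C X B"]) auto
  next
    case (incl k)
    then show ?case by (rule generator)
  next
    case (inv k)
    then obtain m where m: "m \<in> I X B"
      and less: "|{(f, g) \<in> E. Comp C X B A f k \<noteq> Comp C X B A f m}| <o |E|"
      using generator by blast
    have k: "k \<in> Mor C X B"
      using inv in_Mor by blast
    \<comment> \<open>The witness is -m, because post-composition with \<open>f\<close> respects
      negation.\<close>
    have "{(f, g) \<in> E. Comp C X B A f (inv\<^bsub>Hom C X B\<^esub> k) \<noteq> Comp C X B A f (inv\<^bsub>Hom C X B\<^esub> m)}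
        \<subseteq> {(f, g) \<in> E. Comp C X B A f k \<noteq> Comp C X B A f m}"
      using E(1) m k
      by (auto simp: group_hom.hom_inv[OF group_hom_Comp_right[OF X B A]] subset_iff)
    then show ?case
      using less S.m_inv_closed[OF m] card_of_mono1 ordLeq_ordLess_trans by blast
  next
    case (eng h k)
    then obtain m n where m: "m \<in> I X B" and n: "n \<in> I X B"
      and less: "|{(f, g) \<in> E. Comp C X B A f h \<noteq> Comp C X B A f m}| <o |E|"
        "|{(f, g) \<in> E. Comp C X B A f k \<noteq> Comp C X B A f n}| <o |E|"
      by blast
    have hk: "h \<in> Mor C X B" "k \<in> Mor C X B"
      using eng.hyps in_Mor G.generate_in_carrier by blast+
    \<comment> \<open>The witness is m + n. A pair exceptional for the sum is exceptional for a
      summand, and since \<open>E\<close> is infinite, the union of two sets smaller than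
      \<open>E\<close> is again smaller.\<close>
    have "{(f, g) \<in> E. Comp C X B A f (h \<otimes>\<^bsub>Hom C X B\<^esub> k) \<noteq> Comp C X B A f (m \<otimes>\<^bsub>Hom C X B\<^esub> n)}
        \<subseteq> {(f, g) \<in> E. Comp C X B A f h \<noteq> Comp C X B A f m}
          \<union> {(f, g) \<in> E. Comp C X B A f k \<noteq> Comp C X B A f n}"
      using E(1) m n hk
      by (auto simp: hom_mult[OF Comp_hom_right[OF X B A]] subset_iff)
    then show ?case
      using card_of_Un_ordLess_infinite[OF E(2) less] S.m_closed[OF m n]
        card_of_mono1 ordLeq_ordLess_trans by blast
  qed
qed

lemma maximal_cat_ideal_no_obj_prec:
  assumes M: "maximal_cat_ideal C M" and notin: "Ident C A \<notin> M A A"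
  shows "\<not> obj_prec C A B"
proof
  assume "obj_prec C A B"
  then obtain E where A: "A \<in> Obj C" and B: "B \<in> Obj C"
    and E: "E \<subseteq> Mor C B A \<times> Mor C A B" "infinite E"
    and retract: "\<forall>(f, g) \<in> E. Comp C A B A f g = Ident C A"
    and small: "\<forall>\<phi> \<in> Mor C A B. |{(f, g) \<in> E. Comp C A B A f \<phi> \<noteq> Zero C A A}| <o |E|"
    unfolding obj_prec_def by blast
  have I: "cat_ideal C M"
    using M by (simp add: maximal_cat_ideal_def proper_cat_ideal_def)
  have "Ident C B \<in> ideal_adjoin C M A B B"
    using maximal_cat_ideal_adjoin_eq_Mor[OF M A notin B B] Ident_in_Mor[OF B] by simp
  then obtain m where m: "m \<in> M B B"
    and less: "|{(f, g) \<in> E. Comp C B B A f (Ident C B) \<noteq> Comp C B B A f m}| <o |E|"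
    using ideal_adjoin_almost_in_ideal[OF I A B B E] small by blast
  \<comment> \<open>A set of strictly smaller cardinality cannot be all of \<open>E\<close>, so some
    pair in \<open>E\<close> satisfies f = fm.\<close>
  have "{(f, g) \<in> E. Comp C B B A f (Ident C B) \<noteq> Comp C B B A f m} \<noteq> E"
    using less ordLess_irreflexive by metis
  then obtain f g where fg: "(f, g) \<in> E" and eq: "Comp C B B A f (Ident C B) = Comp C B B A f m"
    by blast
  have f: "f \<in> Mor C B A" and g: "g \<in> Mor C A B"
    using fg E(1) by auto
  \<comment> \<open>Here 1 = fg = (fm)g = f(mg), which lies in \<open>M\<close> because
    \<open>m\<close> does.\<close>
  have "Ident C A = Comp C A B A (Comp C B B A f m) g"
    using fg retract eq f A B by (auto simp: Comp_Ident_right)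
  also have "\<dots> = Comp C A B A f (Comp C A B B m g)"
    using Comp_assoc[OF A B B A g cat_ideal_in_Mor[OF I B B m] f] .
  also have "\<dots> \<in> M A A"
    by (rule cat_ideal_Comp[OF I A B B A g m f])
  finally show False using notin by contradiction
qed

end

theorem corollary3p2:
  fixes C :: "('o, 'm) precategory"
  assumes "preadditive_category C"
    and "\<not> (\<exists>A \<in> Obj C. \<not> zero_object C A \<and> maximal_object C A)"
  shows "\<not> (\<exists>I. maximal_cat_ideal C I)"
proof
  interpret preadditive_category C by fact
  assume "\<exists>I. maximal_cat_ideal C I"
  then obtain M where M: "maximal_cat_ideal C M" ..
  then have "proper_cat_ideal C M" by (simp add: maximal_cat_ideal_def)
  \<comment> \<open>The missing identity is used twice: it makes \<open>A\<close> non-zero, and it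
    makes adjoining \<open>Ident C A\<close> enlarge \<open>M\<close>.\<close>
  then obtain A where A: "A \<in> Obj C" "Ident C A \<notin> M A A" and "cat_ideal C M"
    using proper_cat_ideal_Ident_notin unfolding proper_cat_ideal_def by metis
  then have "\<not> zero_object C A"
    using zero_object_Ident_in_cat_ideal by blast
  then obtain B where "obj_prec C A B"
    using A assms(2) unfolding maximal_object_def by blast
  then show False
    using maximal_cat_ideal_no_obj_prec[OF M A(2)] by contradiction
qed

end
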